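(* Let $d\ge1$ and $\alpha\ge1$, and let $X$ and $Y$ be independent random variables uniformly distributed on finite nonempty sets $A\subset\mathbb{Z}^d$ and $B\subset\mathbb{Z}^d$ respectively. Then $$\mathcal{N}_\alpha(X+Y)+1\ge\mathcal{N}_\alpha(X)+\mathcal{N}_\alpha(Y),$$ where $\mathcal{N}_\alpha(Z)=e^{(1+\alpha)H_\alpha(Z)}$.
   Context: Rényi entropy of a discrete random variable $Z$ with pmf $f$: $H_\alpha(Z)=\frac{1}{1-\alpha}\log\sum_z f(z)^\alpha$ for $\alpha>1$, and $H_1(Z)=-\sum_z f(z)\log f(z)$ (Shannon entropy). *)

theory Defs
  imports "HOL-Probability.Probability"
begin

definition mass_fun :: "'w measure \<Rightarrow> ('w \<Rightarrow> 'a) \<Rightarrow> 'a \<Rightarrow> real" where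
  "mass_fun M Z z = measure M (Z -` {z} \<inter> space M)"

(* The conventions 0 powr a = 0 and 0 * ln 0 = 0 are the usual ones for entropy sums.
   Meant for a \<ge> 1. A divergent sum has the value 0 for infsum, which can only occur for
   a = 1 and a Z of infinite Shannon entropy, never for a Z with finitely many values. *)
definition renyi_entropy :: "'w measure \<Rightarrow> real \<Rightarrow> ('w \<Rightarrow> 'a) \<Rightarrow> real" where
  "renyi_entropy M a Z =
     (if a = 1 then - (\<Sum>\<^sub>\<infinity>z. mass_fun M Z z * ln (mass_fun M Z z))
      else 1 / (1 - a) * ln (\<Sum>\<^sub>\<infinity>z. mass_fun M Z z powr a))"

definition renyi_power :: "'w measure \<Rightarrow> real \<Rightarrow> ('w \<Rightarrow> 'a) \<Rightarrow> real" where
  "renyi_power M a Z = exp ((1 + a) * renyi_entropy M a Z)"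

end

theory Submission
  imports Defs
begin

text \<open>
  Let \<open>r x\<close> be the number of representations \<open>x = a + b\<close> and let \<open>m = |A| \<ge> n = |B|\<close>.
  A pair \<open>(a0, b0)\<close> maximizing \<open>|b - a|\<close> gives, by the parallelogram law, a hook
  \<open>{a0} \<times> B \<union> A \<times> {b0}\<close> on which addition is injective; peeling off hooks one after the other
  yields Pollard's inequality \<open>\<Sum> min (r x) t \<ge> t * (m + n - t)\<close>. Summation by parts turns it into
  the statement that \<open>\<Sum> (r x) powr \<alpha>\<close> is largest for two intervals, where \<open>r\<close> is the trapezoid
  \<open>1, ..., n - 1, n, ..., n, n - 1, ..., 1\<close>.

  With \<open>c = (\<alpha> - 1) / (\<alpha> + 1)\<close> the trapezoid sum is at most \<open>n powr \<alpha> * (m - c * (n - 1))\<close>, which gives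
  \<open>N (X + Y) \<ge> m powr (1 + \<alpha>) * exp (y + c * y ^ 2 / 2)\<close> for \<open>y = (n - 1) / m\<close>.
  For \<open>n < m\<close> the bound \<open>exp y \<ge> 1 + y\<close> and Jensen's inequality suffice, and for \<open>m = n \<ge> 4\<close> one has
  \<open>exp y \<ge> 2\<close>; the cases \<open>m = n = 2, 3\<close> are treated separately. The case \<open>\<alpha> = 1\<close> follows by
  letting \<open>\<beta>\<close> tend to \<open>1\<close> from the right, since the Shannon entropy dominates the Renyi entropy of order \<open>\<beta>\<close>.
\<close>

section \<open>Representation counts\<close>

text \<open>A pair for which \<open>w = b0 - a0\<close> has maximal Euclidean length works. If
  \<open>a0 + b = a + b0\<close>, put \<open>v = a - a0 = b - b0\<close>. Then
  \<open>b0 - a = w - v\<close> and \<open>b - a0 = w + v\<close> are no longer than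
  \<open>w\<close>, so the parallelogram law
  \<open>|w - v|^2 + |w + v|^2 = 2 |w|^2 + 2 |v|^2\<close> forces \<open>v = 0\<close>.\<close>

lemma unique_extremal_pair:
  fixes A B :: "(int ^ 'd) set"
  assumes "finite A" "A \<noteq> {}" "finite B" "B \<noteq> {}"
  obtains a0 b0 where "a0 \<in> A" "b0 \<in> B"
    "\<And>a b. a \<in> A \<Longrightarrow> b \<in> B \<Longrightarrow> a0 + b = a + b0 \<Longrightarrow> a = a0 \<and> b = b0"
proof -
  define q where "q v = (\<Sum>i\<in>UNIV. (v $ i)\<^sup>2)" for v :: "int ^ 'd"
  define f where "f p = q (snd p - fst p)" for p
  have fin: "finite (f ` (A \<times> B))" and ne: "f ` (A \<times> B) \<noteq> {}" using assms by auto
  from Max_in[OF this] obtain p where p: "p \<in> A \<times> B" "f p = Max (f ` (A \<times> B))" by auto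
  obtain a0 b0 where ab: "p = (a0, b0)" by force
  have max: "q (b - a) \<le> q (b0 - a0)" if "a \<in> A" "b \<in> B" for a b
    using Max_ge[OF fin imageI[of "(a, b)"]] that p(2)[symmetric] unfolding ab by (auto simp: f_def)
  have "a = a0 \<and> b = b0" if a: "a \<in> A" and b: "b \<in> B" and eq: "a0 + b = a + b0" for a b
  proof -
    define v where "v = a - a0"
    have [simp]: "a = a0 + v" "b = b0 + v" using eq by (auto simp: v_def algebra_simps)
    have "q (b0 - a) + q (b - a0) = 2 * q (b0 - a0) + 2 * q v"
      unfolding q_def sum_distrib_left sum.distrib[symmetric]
      by (intro sum.cong) (auto simp: power2_eq_square algebra_simps)
    moreover have "q (b0 - a) \<le> q (b0 - a0)" "q (b - a0) \<le> q (b0 - a0)"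
      using max[of a b0] max[of a0 b] a b p ab by auto
    ultimately have "q v \<le> 0" by linarith
    moreover have "q v \<ge> 0" unfolding q_def by (simp add: sum_nonneg)
    ultimately have "q v = 0" by linarith
    then have "v = 0" unfolding q_def by (subst (asm) sum_nonneg_eq_0_iff) (auto simp: vec_eq_iff)
    then show ?thesis by simp
  qed
  then show ?thesis using that p ab by auto
qed

text \<open>The unnormalised convolution of the indicator functions of \<open>A\<close> and
  \<open>B\<close>.\<close>

definition rep :: "(int ^ 'd) set \<Rightarrow> (int ^ 'd) set \<Rightarrow> int ^ 'd \<Rightarrow> nat" where
  "rep A B x = card {p \<in> A \<times> B. fst p + snd p = x}"

lemma sum_card_fibres:
  assumes "finite P" "finite U" "f ` P \<subseteq> U"
  shows "(\<Sum>x\<in>U. card {p \<in> P. f p = x}) = card P"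
  using sum.group[OF assms, of "\<lambda>_. 1::nat"] by simp

lemma sum_rep:
  assumes "finite A" "finite B" "finite U" "\<And>a b. a \<in> A \<Longrightarrow> b \<in> B \<Longrightarrow> a + b \<in> U"
  shows "(\<Sum>x\<in>U. rep A B x) = card A * card B"
  unfolding rep_def using assms
  by (subst sum_card_fibres) (auto simp: card_cartesian_product)

lemma rep_eq_card: "rep A B x = card {a \<in> A. x - a \<in> B}"
  unfolding rep_def
  by (rule bij_betw_same_card[of fst])
     (force simp: bij_betw_def inj_on_def image_iff algebra_simps)+

lemma rep_commute: "rep A B x = rep B A x"
  unfolding rep_def
  by (rule bij_betw_same_card[of prod.swap])
     (auto simp: bij_betw_def inj_on_def image_iff algebra_simps)

lemma rep_le_card: "finite A \<Longrightarrow> rep A B x \<le> card A"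
  unfolding rep_eq_card by (rule card_mono) auto

text \<open>Induction on \<open>t\<close>, with \<open>U\<close> fixed while the sets shrink.
  Removing the hook lowers both cardinalities by one and takes away \<open>m + n - 1\<close> pairs
  with distinct sums, which raising the cap from \<open>t\<close> to \<open>t + 1\<close> makes room
  for. The balance is \<open>t (m + n - 2) + (m + n - 1) = (t + 1) (m + n) - (2 t + 1)\<close>. The
  term \<open>t * t\<close> stands on the right to avoid subtraction on \<open>nat\<close>.\<close>

lemma pollard:
  fixes A B U :: "(int ^ 'd) set"
  assumes "finite A" "finite B" "finite U" "\<And>a b. a \<in> A \<Longrightarrow> b \<in> B \<Longrightarrow> a + b \<in> U"
    and "t \<le> card A" "t \<le> card B"
  shows "t * (card A + card B) \<le> (\<Sum>x\<in>U. min (rep A B x) t) + t * t"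
  using assms
proof (induction t arbitrary: A B)
  case 0
  then show ?case by simp
next
  case (Suc t)
  have "A \<noteq> {}" "B \<noteq> {}" using Suc.prems by auto
  with Suc.prems obtain a0 b0 where ab: "a0 \<in> A" "b0 \<in> B"
    and uniq: "\<And>a b. a \<in> A \<Longrightarrow> b \<in> B \<Longrightarrow> a0 + b = a + b0 \<Longrightarrow> a = a0 \<and> b = b0"
    using unique_extremal_pair[of A B] by metis
  \<comment> \<open>The second arm omits the corner \<open>(a0, b0)\<close>, so the union is
    disjoint.\<close>
  define H where "H = {a0} \<times> B \<union> (A - {a0}) \<times> {b0}"
  define h where "h x = card {p \<in> H. fst p + snd p = x}" for x
  have finH: "finite H" unfolding H_def using Suc.prems by auto
  \<comment> \<open>Pairs in the same arm are separated by cancellation, pairs in different arms by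
    the choice of \<open>(a0, b0)\<close>.\<close>
  have inj: "inj_on (\<lambda>p. fst p + snd p) H"
    using uniq by (auto simp: inj_on_def H_def dest: uniq[OF _ _ sym])
  have h1: "h x \<le> 1" for x
    unfolding h_def using inj by (intro card_le_Suc0_iff_eq[THEN iffD2, simplified One_nat_def[symmetric]])
      (auto simp: finH inj_on_def)
  have "card H = card B + (card A - 1)"
    unfolding H_def using Suc.prems ab by (subst card_Un_disjoint) (auto simp: card_cartesian_product)
  moreover have "(\<Sum>x\<in>U. h x) = card H"
    unfolding h_def using Suc.prems ab finH by (intro sum_card_fibres) (auto simp: H_def)
  ultimately have sumh: "(\<Sum>x\<in>U. h x) + 1 = card A + card B" using Suc.prems by simp
  define A' B' where "A' = A - {a0}" and "B' = B - {b0}"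
  have c: "card A = Suc (card A')" "card B = Suc (card B')"
    unfolding A'_def B'_def using Suc.prems ab by (simp_all add: card_Suc_Diff1)
  have rep: "rep A B x = rep A' B' x + h x" for x
  proof -
    have "{p \<in> A \<times> B. fst p + snd p = x} =
        {p \<in> A' \<times> B'. fst p + snd p = x} \<union> {p \<in> H. fst p + snd p = x}"
      using ab by (auto simp: A'_def B'_def H_def)
    moreover have "finite {p \<in> A' \<times> B'. fst p + snd p = x}" "finite {p \<in> H. fst p + snd p = x}"
      using Suc.prems finH by (auto simp: A'_def B'_def)
    moreover have "{p \<in> A' \<times> B'. fst p + snd p = x} \<inter> {p \<in> H. fst p + snd p = x} = {}"
      by (auto simp: A'_def B'_def H_def)
    ultimately show ?thesis unfolding rep_def h_def by (simp add: card_Un_disjoint)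
  qed
  have "t * (card A' + card B') \<le> (\<Sum>x\<in>U. min (rep A' B' x) t) + t * t"
    using Suc.prems c by (intro Suc.IH) (auto simp: A'_def B'_def)
  moreover have "(\<Sum>x\<in>U. min (rep A' B' x) t) + (\<Sum>x\<in>U. h x) \<le> (\<Sum>x\<in>U. min (rep A B x) (Suc t))"
    unfolding sum.distrib[symmetric]
  proof (rule sum_mono)
    fix x show "min (rep A' B' x) t + h x \<le> min (rep A B x) (Suc t)" using rep[of x] h1[of x] by simp
  qed
  ultimately show ?case using sumh c by (simp add: algebra_simps)
qed

section \<open>Summation by parts against the trapezoid\<close>

text \<open>Abel summation. With the increments of the power function as \<open>d\<close>, it
  expresses \<open>r powr \<alpha>\<close> through \<open>r\<close> and its truncations, with
  coefficients whose sign is governed by convexity.\<close>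

lemma sum_eq_combination_of_min:
  fixes d :: "nat \<Rightarrow> real"
  assumes "r \<le> n"
  shows "(\<Sum>j<r. d j) = d n * real r - (\<Sum>t<n. (d (Suc t) - d t) * real (min r (Suc t)))"
  using assms
proof (induction n)
  case 0
  then show ?case by simp
next
  case (Suc n)
  show ?case
  proof (cases "r = Suc n")
    case True
    have "(\<Sum>t<Suc n. (d (Suc t) - d t) * real (Suc t)) = d (Suc n) * real (Suc n) - (\<Sum>j<Suc n. d j)" for n
      by (induction n) (auto simp: algebra_simps)
    moreover have "(\<Sum>t<Suc n. (d (Suc t) - d t) * real (min r (Suc t))) =
        (\<Sum>t<Suc n. (d (Suc t) - d t) * real (Suc t))"
      using True by (intro sum.cong) (auto simp: min_def)
    ultimately show ?thesis using True by simp
  next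
    case False
    with Suc show ?thesis by (simp add: algebra_simps)
  qed
qed

text \<open>The same summation with Pollard's bounds \<open>t (s - t)\<close> in place of the
  truncated sums. For \<open>s = m + n\<close> the weight \<open>s - 2 j - 1\<close> counts the
  points at which the trapezoid exceeds \<open>j\<close>.\<close>

lemma summation_by_parts_trapezoid:
  fixes d :: "nat \<Rightarrow> real" and s :: real
  shows "d n * real n * (s - real n) - (\<Sum>t<n. (d (Suc t) - d t) * (real (Suc t) * (s - real (Suc t)))) =
    (\<Sum>j<n. d j * (s - 2 * real j - 1))"
  by (induction n) (auto simp: algebra_simps)

text \<open>Regroups the levels by height: for \<open>s = m + n\<close>, each positive
  \<open>k < n\<close> occurs twice and \<open>n\<close> occurs \<open>m - n + 1\<close>
  times.\<close>

lemma trapezoid_powr: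
  fixes \<alpha> s :: real
  shows "(\<Sum>j<n. (real (Suc j) powr \<alpha> - real j powr \<alpha>) * (s - 2 * real j - 1)) =
    2 * (\<Sum>k<n. real k powr \<alpha>) + (s - 2 * real n + 1) * real n powr \<alpha>"
  by (induction n) (auto simp: algebra_simps)

lemma midpoint_powr:
  fixes \<alpha> :: real
  assumes "\<alpha> \<ge> 1"
  shows "2 * real (Suc j) powr \<alpha> \<le> real j powr \<alpha> + real (Suc (Suc j)) powr \<alpha>"
proof (cases "j = 0")
  case True
  then show ?thesis using powr_mono[of 1 \<alpha> 2] assms by simp
next
  case False
  have "((1/2) * real j + (1/2) * real (Suc (Suc j))) powr \<alpha>
      \<le> (1/2) * real j powr \<alpha> + (1/2) * real (Suc (Suc j)) powr \<alpha>"
    using convex_onD[OF powr_convex[OF assms], of "1/2" "real j" "real (Suc (Suc j))"] False by simp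
  also have "(1/2) * real j + (1/2) * real (Suc (Suc j)) = real (Suc j)" by (simp add: field_simps)
  finally show ?thesis by simp
qed

lemma sum_rep_powr_le:
  fixes A B U :: "(int ^ 'd) set" and \<alpha> :: real
  assumes "finite A" "finite B" "finite U" "\<And>a b. a \<in> A \<Longrightarrow> b \<in> B \<Longrightarrow> a + b \<in> U"
    and B: "B \<noteq> {}" "card B \<le> card A" and \<alpha>: "\<alpha> \<ge> 1"
  shows "(\<Sum>x\<in>U. real (rep A B x) powr \<alpha>) \<le>
    2 * (\<Sum>k<card B. real k powr \<alpha>) + (real (card A) - card B + 1) * real (card B) powr \<alpha>"
proof -
  define n s d where "n = card B" and "s = real (card A + card B)"
    and "d j = real (Suc j) powr \<alpha> - real j powr \<alpha>" for j
  \<comment> \<open>Convexity makes the coefficients of the truncated sums nonnegative. As these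
    sums enter with a minus sign, Pollard's lower bounds yield an upper bound.\<close>
  have d: "d t \<le> d (Suc t)" for t
    unfolding d_def using midpoint_powr[OF \<alpha>, of t] by simp
  have tel: "(\<Sum>j<r. d j) = real r powr \<alpha>" for r
    using sum_lessThan_telescope[of "\<lambda>j. real j powr \<alpha>" r] \<alpha> unfolding d_def by simp
  have rn: "rep A B x \<le> n" for x
    unfolding n_def using rep_le_card[of B A x] rep_commute[of A B x] assms by simp
  have pol: "real (Suc t) * (s - real (Suc t)) \<le> (\<Sum>x\<in>U. real (min (rep A B x) (Suc t)))" if "t < n" for t
  proof -
    have "real (Suc t * (card A + card B)) \<le> real ((\<Sum>x\<in>U. min (rep A B x) (Suc t)) + Suc t * Suc t)"
      using pollard[OF assms(1-4), of "Suc t"] that assms(6) unfolding n_def of_nat_le_iff by simp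
    then show ?thesis unfolding s_def by (simp add: algebra_simps)
  qed
  have sr: "(\<Sum>x\<in>U. real (rep A B x)) = real n * (s - real n)"
    using sum_rep[OF assms(1-4)] unfolding n_def s_def by (simp flip: of_nat_sum)
  have "(\<Sum>x\<in>U. real (rep A B x) powr \<alpha>) =
      (\<Sum>x\<in>U. d n * real (rep A B x) - (\<Sum>t<n. (d (Suc t) - d t) * real (min (rep A B x) (Suc t))))"
    unfolding tel[symmetric] using rn by (intro sum.cong sum_eq_combination_of_min) auto
  also have "\<dots> = d n * real n * (s - real n) -
      (\<Sum>t<n. (d (Suc t) - d t) * (\<Sum>x\<in>U. real (min (rep A B x) (Suc t))))"
    unfolding sum_subtractf sum_distrib_left[symmetric] sr
    by (subst sum.swap) (simp add: sum_distrib_left)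
  also have "\<dots> \<le> d n * real n * (s - real n) - (\<Sum>t<n. (d (Suc t) - d t) * (real (Suc t) * (s - real (Suc t))))"
    using d pol by (intro diff_left_mono sum_mono mult_left_mono) auto
  also have "\<dots> = (\<Sum>j<n. d j * (s - 2 * real j - 1))" by (rule summation_by_parts_trapezoid)
  also have "\<dots> = 2 * (\<Sum>k<n. real k powr \<alpha>) + (s - 2 * real n + 1) * real n powr \<alpha>"
    unfolding d_def by (rule trapezoid_powr)
  finally show ?thesis by (simp add: n_def s_def algebra_simps)
qed

section \<open>The trapezoid\<close>

text \<open>Weighted AM-GM for \<open>1 + \<alpha> * x\<close> and \<open>1\<close> with weights
  \<open>1 / \<alpha>\<close> and \<open>1 - 1 / \<alpha>\<close>, raised to the power
  \<open>\<alpha>\<close>.\<close>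

lemma Bernoulli_powr:
  fixes x \<alpha> :: real
  assumes "x \<ge> 0" "\<alpha> \<ge> 1"
  shows "1 + \<alpha> * x \<le> (1 + x) powr \<alpha>"
proof -
  have "(1 + \<alpha> * x) powr (1 / \<alpha>) * 1 powr (1 - 1 / \<alpha>) \<le> (1 / \<alpha>) * (1 + \<alpha> * x) + (1 - 1 / \<alpha>) * 1"
    using assms by (intro Youngs_inequality_0) (auto simp: add_pos_nonneg)
  also have "\<dots> = 1 + x" using assms by (simp add: field_simps)
  finally have "((1 + \<alpha> * x) powr (1 / \<alpha>)) powr \<alpha> \<le> (1 + x) powr \<alpha>"
    using assms by (intro powr_mono2) auto
  then show ?thesis using assms by (simp add: powr_powr add_nonneg_nonneg)
qed

text \<open>An equality for \<open>\<alpha> = 1\<close>. The induction step needs \<open>(n + 1 +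
  \<alpha>) (n + 1)^\<alpha> \<le> (n + 1) (n + 2)^\<alpha>\<close>, which is Bernoulli's inequality
  at \<open>1 / (n + 1)\<close>.\<close>

lemma sum_powr_le:
  fixes \<alpha> :: real
  assumes "\<alpha> \<ge> 1"
  shows "(\<alpha> + 1) * (\<Sum>k<Suc n. real k powr \<alpha>) \<le> real n * real (Suc n) powr \<alpha>"
proof (induction n)
  case 0
  then show ?case by simp
next
  case (Suc n)
  have "(\<alpha> + 1) * (\<Sum>k<Suc (Suc n). real k powr \<alpha>) \<le>
      real (Suc n) * ((1 + \<alpha> * (1 / real (Suc n))) * real (Suc n) powr \<alpha>)"
  proof -
    have "real (Suc n) * ((1 + \<alpha> * (1 / real (Suc n))) * real (Suc n) powr \<alpha>) =
        (real n + 1 + \<alpha>) * real (Suc n) powr \<alpha>"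
      by (simp add: divide_simps)
    then show ?thesis
      using Suc.IH by (subst sum.lessThan_Suc) (simp add: algebra_simps)
  qed
  also have "\<dots> \<le> real (Suc n) * ((1 + 1 / real (Suc n)) powr \<alpha> * real (Suc n) powr \<alpha>)"
    using assms by (intro mult_left_mono mult_right_mono Bernoulli_powr) auto
  also have "(1 + 1 / real (Suc n)) powr \<alpha> * real (Suc n) powr \<alpha> =
      ((1 + 1 / real (Suc n)) * real (Suc n)) powr \<alpha>"
    by (subst powr_mult) auto
  also have "(1 + 1 / real (Suc n)) * real (Suc n) = real (Suc (Suc n))" by (simp add: field_simps)
  finally show ?case .
qed

text \<open>The constant \<open>c\<close> arises here as \<open>1 - 2 / (\<alpha> + 1)\<close>: the
  plateau contributes \<open>-(n - 1)\<close> and the two slopes at most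
  \<open>2 (n - 1) / (\<alpha> + 1)\<close>.\<close>

lemma trapezoid_powr_le:
  fixes \<alpha> m :: real
  assumes "\<alpha> \<ge> 1" "n \<ge> 1"
  shows "2 * (\<Sum>k<n. real k powr \<alpha>) + (m - real n + 1) * real n powr \<alpha>
    \<le> real n powr \<alpha> * (m - (\<alpha> - 1) / (\<alpha> + 1) * (real n - 1))"
proof -
  obtain k where k: "n = Suc k" using assms by (cases n) auto
  have "(\<Sum>k<n. real k powr \<alpha>) \<le> (real n - 1) * real n powr \<alpha> / (\<alpha> + 1)"
    using sum_powr_le[OF assms(1), of k] assms k by (simp add: field_simps)
  then have "2 * (\<Sum>k<n. real k powr \<alpha>) + (m - real n + 1) * real n powr \<alpha>
      \<le> 2 * ((real n - 1) * real n powr \<alpha> / (\<alpha> + 1)) + (m - real n + 1) * real n powr \<alpha>" by simp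
  also have "\<dots> = real n powr \<alpha> * (m - (\<alpha> - 1) / (\<alpha> + 1) * (real n - 1))"
    using assms by (simp add: divide_simps) (simp add: algebra_simps)
  finally show ?thesis .
qed

section \<open>Logarithm and exponential estimates\<close>

text \<open>The quadratic term is kept for the case \<open>m = n = 3\<close>, where the linear one
  does not suffice for large \<open>\<alpha>\<close>.\<close>

lemma ln_one_minus_le:
  fixes t :: real
  assumes "0 \<le> t" "t < 1"
  shows "ln (1 - t) \<le> - t - t\<^sup>2 / 2"
proof -
  define f where "f x = ln (1 - x) + x + x\<^sup>2 / 2" for x :: real
  have "f t \<le> f 0"
  proof (rule DERIV_nonpos_imp_nonincreasing[OF assms(1)])
    fix x assume x: "0 \<le> x" "x \<le> t"
    then have "(f has_real_derivative - x\<^sup>2 / (1 - x)) (at x)"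
      unfolding f_def using assms(2)
      by (auto intro!: derivative_eq_intros simp: field_simps power2_eq_square)
    then show "\<exists>y. (f has_real_derivative y) (at x) \<and> y \<le> 0"
      using x assms(2) by (intro exI[of _ "- x\<^sup>2 / (1 - x)"]) (auto simp: divide_nonpos_pos)
  qed
  then show ?thesis by (simp add: f_def)
qed

text \<open>The case \<open>m = n = 2\<close> with \<open>\<beta> = \<alpha> - 1\<close>; equality
  holds at \<open>\<beta> = 0\<close>. For \<open>\<beta> \<ge> 2\<close> the left side is at most
  \<open>1\<close> by \<open>ln (1 + u) \<le> u\<close>. For \<open>\<beta> < 2\<close> the
  difference, divided by \<open>\<beta> + 2\<close>, vanishes at \<open>0\<close> and is
  nondecreasing.\<close>

lemma ln_one_plus_two_powr_le:
  fixes \<beta> :: real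
  assumes "\<beta> \<ge> 0"
  shows "(\<beta> + 2) * ln (1 + 2 powr (-\<beta>)) \<le> 2 * ln 2"
proof (cases "\<beta> \<ge> 2")
  case True
  have "1 + (\<beta> - 1) * 1 \<le> (1 + 1) powr (\<beta> - 1)"
    using True by (intro order.trans[OF _ Bernoulli_powr]) auto
  then have "\<beta> + 2 \<le> 2 powr \<beta>" using True by (simp add: powr_diff)
  then have "(\<beta> + 2) * 2 powr (-\<beta>) \<le> 1" by (simp add: powr_minus field_simps)
  moreover have "(\<beta> + 2) * ln (1 + 2 powr (-\<beta>)) \<le> (\<beta> + 2) * 2 powr (-\<beta>)"
    using True by (intro mult_left_mono ln_add_one_self_le_self) auto
  ultimately show ?thesis using ln2_ge_two_thirds by linarith
next
  case False
  define G where "G x = 2 * ln 2 / (x + 2) - ln (1 + 2 powr (-x))" for x :: real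
  have "G 0 \<le> G \<beta>"
  proof (rule DERIV_nonneg_imp_nondecreasing[OF assms])
    fix x assume x: "0 \<le> x" "x \<le> \<beta>"
    \<comment> \<open>The chord of \<open>2 powr x\<close> between \<open>x = 0\<close> and
      \<open>x = 2\<close>, where the values are \<open>1\<close> and \<open>4\<close>. The
      derivative of \<open>G\<close> is nonnegative exactly when
      \<open>2 (1 + 2 powr x) \<le> (x + 2)^2\<close>.\<close>
    have "exp ((1 - x/2) *\<^sub>R 0 + (x/2) *\<^sub>R (2 * ln 2)) \<le> (1 - x/2) * exp 0 + (x/2) * exp (2 * ln 2)"
      using x False by (intro convex_onD[OF exp_convex]) auto
    moreover have "exp (2 * ln 2) = (4::real)" by (simp add: exp_double)
    ultimately have "2 powr x \<le> 1 + 3/2 * x" by (simp add: powr_def algebra_simps)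
    then have "2 * (1 + 2 powr x) \<le> 2 * (1 + (1 + 3/2 * x))" by (intro mult_left_mono add_left_mono) auto
    also have "\<dots> = 4 + 3 * x" by simp
    also have "\<dots> \<le> 4 + 4 * x + x\<^sup>2" using x by simp
    also have "\<dots> = (x + 2)\<^sup>2" by (simp add: power2_eq_square algebra_simps)
    finally have "2 * (1 + 2 powr x) \<le> (x + 2)\<^sup>2" .
    then have "0 \<le> ln 2 * (1 / (1 + 2 powr x) - 2 / (x + 2)\<^sup>2)"
      using x by (intro mult_nonneg_nonneg) (auto simp: field_simps add_pos_pos)
    also have "\<dots> = - (2 * ln 2) / (x + 2)\<^sup>2 + ln 2 * 2 powr (-x) / (1 + 2 powr (-x))"
      using x by (simp add: powr_minus field_simps add_pos_pos)
    finally have "0 \<le> - (2 * ln 2) / (x + 2)\<^sup>2 + ln 2 * 2 powr (-x) / (1 + 2 powr (-x))" .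
    moreover have "(G has_real_derivative - (2 * ln 2) / (x + 2)\<^sup>2 + ln 2 * 2 powr (-x) / (1 + 2 powr (-x))) (at x)"
      unfolding G_def using x
      by (auto intro!: derivative_eq_intros simp: add_pos_pos power2_eq_square)
    ultimately show "\<exists>y. (G has_real_derivative y) (at x) \<and> 0 \<le> y" by blast
  qed
  then have "0 \<le> G \<beta>" by (simp add: G_def)
  then show ?thesis using assms by (simp add: G_def field_simps)
qed

text \<open>Jensen's inequality for \<open>n\<close> as the mean of \<open>n + 1\<close> and
  \<open>1\<close> with weights \<open>1 - 1 / n\<close> and \<open>1 / n\<close>. For
  \<open>n < m\<close> this is the source of the \<open>+ 1\<close> in the theorem.\<close>

lemma powr_convex_step:
  fixes \<alpha> :: real
  assumes "\<alpha> \<ge> 1" "n \<ge> 1"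
  shows "real n powr (1 + \<alpha>) \<le> (real n - 1) * (real n + 1) powr \<alpha> + 1"
proof -
  have "((1 - 1 / n) *\<^sub>R (real n + 1) + (1 / n) *\<^sub>R 1) powr \<alpha>
      \<le> (1 - 1 / n) * (real n + 1) powr \<alpha> + (1 / n) * 1 powr \<alpha>"
    using assms by (intro convex_onD[OF powr_convex]) auto
  also have "(1 - 1 / n) *\<^sub>R (real n + 1) + (1 / n) *\<^sub>R 1 = real n" using assms by (simp add: field_simps)
  finally have "real n * real n powr \<alpha> \<le> real n * ((1 - 1 / n) * (real n + 1) powr \<alpha> + (1 / n) * 1 powr \<alpha>)"
    by (intro mult_left_mono) auto
  also have "\<dots> = (real n - 1) * (real n + 1) powr \<alpha> + 1" using assms by (simp add: field_simps)
  finally show ?thesis using assms by (simp add: powr_add)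
qed

text \<open>The number \<open>3 / 4\<close> is the least value of \<open>(n - 1) / n\<close> for
  \<open>n \<ge> 4\<close>.\<close>

lemma two_le_exp_three_quarters: "2 \<le> exp (3 / 4 :: real)"
proof -
  have "2 \<le> (1 + 3/8 + (3/8)\<^sup>2 / 2 :: real)\<^sup>2" by (simp add: power2_eq_square)
  also have "\<dots> \<le> (exp (3/8))\<^sup>2" by (intro power_mono exp_lower_Taylor_quadratic) auto
  also have "\<dots> = exp (3/4)" by (simp flip: exp_double)
  finally show ?thesis .
qed

text \<open>Here \<open>y = 2/3\<close>, and \<open>exp (2/3)\<close> falls just short of
  \<open>2\<close>. For \<open>\<alpha> \<le> 3/2\<close> the loss is at most \<open>1/16\<close> of
  a power that is at most \<open>16\<close>, so the \<open>+ 1\<close> pays for it. For larger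
  \<open>\<alpha>\<close> one has \<open>c \<ge> 1/5\<close>, and the quadratic term lifts the
  exponent to at least \<open>32/45\<close>, which is enough.\<close>

lemma power_gap_three:
  fixes \<alpha> :: real
  assumes "\<alpha> > 1"
  shows "2 * 3 powr (1 + \<alpha>) \<le> 3 powr (1 + \<alpha>) * exp (2/3 + (\<alpha> - 1) / (\<alpha> + 1) * (2/3)\<^sup>2 / 2) + 1"
proof (cases "\<alpha> \<le> 3/2")
  case True
  have "3 powr (1 + \<alpha>) \<le> 3 powr (2 + 1/2 :: real)" using True by (intro powr_mono) auto
  also have "\<dots> = 9 * sqrt 3" unfolding powr_add by (simp add: powr_half_sqrt)
  also have "\<dots> \<le> 16" using real_le_lsqrt[of "16/9" 3] by (simp add: power2_eq_square)
  finally have *: "3 powr (1 + \<alpha>) \<le> 16" .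
  have "31/16 \<le> (1 + 1/6 + (1/6)\<^sup>2 / 2 :: real) ^ 4" by (simp add: power2_eq_square power4_eq_xxxx)
  also have "\<dots> \<le> (exp (1/6)) ^ 4" by (intro power_mono exp_lower_Taylor_quadratic) auto
  also have "\<dots> = exp (2/3)" by (simp flip: exp_of_nat_mult)
  also have "\<dots> \<le> exp (2/3 + (\<alpha> - 1) / (\<alpha> + 1) * (2/3)\<^sup>2 / 2)" using assms by simp
  finally have "3 powr (1 + \<alpha>) * (31/16) \<le> 3 powr (1 + \<alpha>) * exp (2/3 + (\<alpha> - 1) / (\<alpha> + 1) * (2/3)\<^sup>2 / 2)"
    by (intro mult_left_mono) auto
  with * show ?thesis by linarith
next
  case False
  then have "1/5 * ((2/3)\<^sup>2 / 2) \<le> (\<alpha> - 1) / (\<alpha> + 1) * ((2/3)\<^sup>2 / 2)"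
    by (intro mult_right_mono) (auto simp: field_simps)
  moreover have "1/5 * ((2/3)\<^sup>2 / 2) = (2/45 :: real)" by (simp add: power2_eq_square)
  ultimately have c: "32/45 \<le> 2/3 + (\<alpha> - 1) / (\<alpha> + 1) * (2/3)\<^sup>2 / 2" by linarith
  have "2 \<le> (1 + 8/45 + (8/45)\<^sup>2 / 2 :: real) ^ 4" by (simp add: power2_eq_square power4_eq_xxxx)
  also have "\<dots> \<le> (exp (8/45)) ^ 4" by (intro power_mono exp_lower_Taylor_quadratic) auto
  also have "\<dots> = exp (32/45)" by (simp flip: exp_of_nat_mult)
  also have "\<dots> \<le> exp (2/3 + (\<alpha> - 1) / (\<alpha> + 1) * (2/3)\<^sup>2 / 2)" using c by simp
  finally have "3 powr (1 + \<alpha>) * 2 \<le> 3 powr (1 + \<alpha>) * exp (2/3 + (\<alpha> - 1) / (\<alpha> + 1) * (2/3)\<^sup>2 / 2)"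
    by (intro mult_left_mono) auto
  then show ?thesis by linarith
qed

text \<open>Bounding the trapezoid sum by \<open>c\<close> loses too much for \<open>m = n = 2\<close>, so its exact value \<open>2 + 2 powr \<alpha>\<close> is used.\<close>

lemma power_gap_two:
  fixes \<alpha> S :: real
  assumes "\<alpha> > 1" "S > 0" "S \<le> 2 + 2 powr \<alpha>"
  shows "2 * 2 powr (1 + \<alpha>) \<le> exp ((1 + \<alpha>) * (1 / (1 - \<alpha>) * ln (S / 4 powr \<alpha>)))"
proof -
  define u where "u = 2 powr (-(\<alpha> - 1))"
  have u: "u > 0" by (simp add: u_def)
  have 4: "4 powr \<alpha> = 2 powr \<alpha> * 2 powr \<alpha>" using powr_mult[of 2 2 \<alpha>] by simp
  have e: "2 + 2 powr \<alpha> = 2 powr \<alpha> * (1 + u)"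
    unfolding u_def by (simp add: powr_minus powr_diff field_simps)
  have "ln (S / 4 powr \<alpha>) \<le> ln ((1 + u) / 2 powr \<alpha>)"
    using assms u 4 e by (subst ln_le_cancel_iff) (auto simp: field_simps)
  also have "\<dots> = ln (1 + u) - \<alpha> * ln 2" using u by (simp add: ln_div ln_powr)
  finally have "(\<alpha> + 1) * ln (S / 4 powr \<alpha>) \<le> (\<alpha> + 1) * (ln (1 + u) - \<alpha> * ln 2)"
    using assms by (intro mult_left_mono) auto
  moreover have "(\<alpha> + 1) * ln (1 + u) \<le> 2 * ln 2"
    using ln_one_plus_two_powr_le[of "\<alpha> - 1"] assms unfolding u_def by (simp add: algebra_simps)
  ultimately have "(\<alpha> + 1) * ln (S / 4 powr \<alpha>) \<le> 2 * ln 2 - (\<alpha> + 1) * \<alpha> * ln 2"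
    by (simp add: algebra_simps)
  \<comment> \<open>The factor \<open>1 - \<alpha>\<close> is negative, so dividing by it reverses
    the inequality and leaves the exponent of \<open>2 powr (\<alpha> + 2)\<close>.\<close>
  also have "\<dots> = (1 - \<alpha>) * ((\<alpha> + 2) * ln 2)" by (simp add: algebra_simps)
  finally have "(\<alpha> + 2) * ln 2 \<le> (1 + \<alpha>) * (1 / (1 - \<alpha>) * ln (S / 4 powr \<alpha>))"
    using assms by (simp add: divide_simps mult_ac add_ac split: if_splits)
  then have "exp ((\<alpha> + 2) * ln 2) \<le> exp ((1 + \<alpha>) * (1 / (1 - \<alpha>) * ln (S / 4 powr \<alpha>)))" by simp
  moreover have "exp ((\<alpha> + 2) * ln 2) = 2 * 2 powr (1 + \<alpha>)"
    by (simp add: powr_add powr_def exp_add algebra_simps exp_double flip: mult_exp_exp)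
  ultimately show ?thesis by simp
qed

section \<open>The power inequality for the trapezoid\<close>

text \<open>The hypothesis reads \<open>S / (m n)^\<alpha> \<le> m^(1 - \<alpha>) (1 - c y)\<close>.
  Taking logarithms and multiplying by \<open>(1 + \<alpha>) / (1 - \<alpha>) = - 1 / c\<close>
  reverses the inequality, and \<open>- ln (1 - c y) / c \<ge> y + c y^2 / 2\<close>.\<close>

lemma exp_lower_bound:
  fixes \<alpha> S :: real and m n :: nat
  assumes \<alpha>: "\<alpha> > 1" and n: "1 \<le> n" "n \<le> m" and S: "S > 0"
    "S \<le> real n powr \<alpha> * (real m - (\<alpha> - 1) / (\<alpha> + 1) * (real n - 1))"
  defines "y \<equiv> (real n - 1) / real m"
  shows "real m powr (1 + \<alpha>) * exp (y + (\<alpha> - 1) / (\<alpha> + 1) * y\<^sup>2 / 2)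
    \<le> exp ((1 + \<alpha>) * (1 / (1 - \<alpha>) * ln (S / (real m * real n) powr \<alpha>)))"
proof -
  define c where "c = (\<alpha> - 1) / (\<alpha> + 1)"
  have c: "0 < c" "c < 1" using \<alpha> by (auto simp: c_def)
  have y: "0 \<le> y" "y < 1" using n by (auto simp: y_def)
  then have cy: "0 \<le> c * y" "c * y < 1" using c mult_strict_mono[of c 1 y 1] by auto
  have "S \<le> real n powr \<alpha> * (real m * (1 - c * y))"
  proof -
    have "real m * (1 - c * y) = real m - c * (real n - 1)" 
    proof -
      have "real m * y = real n - 1" using n by (simp add: y_def)
      then have "c * (real m * y) = c * (real n - 1)" by simp
      then show ?thesis by (simp add: algebra_simps)
    qed
    then show ?thesis using S by (simp add: c_def)
  qed
  then have "S / (real m * real n) powr \<alpha> \<le> real m powr (1 - \<alpha>) * (1 - c * y)"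
    using n by (simp add: powr_mult powr_diff divide_simps mult_ac)
  then have "ln (S / (real m * real n) powr \<alpha>) \<le> ln (real m powr (1 - \<alpha>) * (1 - c * y))"
    using S n cy by (subst ln_le_cancel_iff) auto
  also have "\<dots> = (1 - \<alpha>) * ln (real m) + ln (1 - c * y)" using cy n by (simp add: ln_mult ln_powr)
  also have "\<dots> \<le> (1 - \<alpha>) * ln (real m) + (- (c * y) - (c * y)\<^sup>2 / 2)"
    using ln_one_minus_le[OF cy] by simp
  also have "\<dots> = (1 - \<alpha>) / (1 + \<alpha>) * ((1 + \<alpha>) * ln (real m) + (y + c * y\<^sup>2 / 2))"
  proof -
    have r: "(1 - \<alpha>) / (1 + \<alpha>) = - c" using \<alpha> by (simp add: c_def field_simps)
    have "(1 - \<alpha>) / (1 + \<alpha>) * ((1 + \<alpha>) * ln (real m) + (y + c * y\<^sup>2 / 2)) =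
        (1 - \<alpha>) / (1 + \<alpha>) * ((1 + \<alpha>) * ln (real m)) + (1 - \<alpha>) / (1 + \<alpha>) * (y + c * y\<^sup>2 / 2)"
      by (rule distrib_left)
    also have "(1 - \<alpha>) / (1 + \<alpha>) * ((1 + \<alpha>) * ln (real m)) = (1 - \<alpha>) * ln (real m)"
      using \<alpha> by simp
    also have "(1 - \<alpha>) / (1 + \<alpha>) * (y + c * y\<^sup>2 / 2) = - (c * y) - (c * y)\<^sup>2 / 2"
      unfolding r by (simp add: algebra_simps power2_eq_square)
    finally show ?thesis by simp
  qed
  finally have "ln (S / (real m * real n) powr \<alpha>)
      \<le> (1 - \<alpha>) / (1 + \<alpha>) * ((1 + \<alpha>) * ln (real m) + (y + c * y\<^sup>2 / 2))" .
  moreover have "R \<le> (1 + \<alpha>) * (1 / (1 - \<alpha>) * L)" if "L \<le> (1 - \<alpha>) / (1 + \<alpha>) * R" for L R :: real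
    using that \<alpha> by (simp add: field_simps)
  ultimately have "(1 + \<alpha>) * ln (real m) + (y + c * y\<^sup>2 / 2)
      \<le> (1 + \<alpha>) * (1 / (1 - \<alpha>) * ln (S / (real m * real n) powr \<alpha>))"
    by blast
  then have "exp ((1 + \<alpha>) * ln (real m) + (y + c * y\<^sup>2 / 2))
      \<le> exp ((1 + \<alpha>) * (1 / (1 - \<alpha>) * ln (S / (real m * real n) powr \<alpha>)))" by simp
  then show ?thesis using n by (simp add: exp_add powr_def c_def)
qed

lemma trapezoid_power_ineq:
  fixes \<alpha> S :: real and m n :: nat
  assumes \<alpha>: "\<alpha> > 1" and n: "1 \<le> n" "n \<le> m" and S: "S > 0"
    "S \<le> 2 * (\<Sum>k<n. real k powr \<alpha>) + (real m - real n + 1) * real n powr \<alpha>"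
  shows "real m powr (1 + \<alpha>) + real n powr (1 + \<alpha>)
    \<le> exp ((1 + \<alpha>) * (1 / (1 - \<alpha>) * ln (S / (real m * real n) powr \<alpha>))) + 1" (is "_ \<le> ?E + 1")
proof -
  define y where "y = (real n - 1) / real m"
  have y: "0 \<le> y" using n by (simp add: y_def)
  have E: "real m powr (1 + \<alpha>) * exp (y + (\<alpha> - 1) / (\<alpha> + 1) * y\<^sup>2 / 2) \<le> ?E"
    using exp_lower_bound[OF \<alpha> n S(1) order.trans[OF S(2) trapezoid_powr_le]] \<alpha> n
    unfolding y_def by simp
  have "exp y \<le> exp (y + (\<alpha> - 1) / (\<alpha> + 1) * y\<^sup>2 / 2)" using \<alpha> by simp
  then have "real m powr (1 + \<alpha>) * exp y \<le> real m powr (1 + \<alpha>) * exp (y + (\<alpha> - 1) / (\<alpha> + 1) * y\<^sup>2 / 2)"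
    by (intro mult_left_mono) auto
  with E have E1: "real m powr (1 + \<alpha>) * exp y \<le> ?E" by linarith
  consider "n < m" | "m = n" "n = 1" | "m = n" "n = 2" | "m = n" "n = 3" | "m = n" "n \<ge> 4"
    using n by linarith
  then show ?thesis
  proof cases
    case 1
    \<comment> \<open>As \<open>n + 1 \<le> m\<close>, the smaller power minus one is at most
      \<open>(n - 1) m^\<alpha> = m^(1 + \<alpha>) y\<close>, which the linear term of
      \<open>exp y\<close> absorbs.\<close>
    have "real n powr (1 + \<alpha>) \<le> (real n - 1) * (real n + 1) powr \<alpha> + 1"
      using powr_convex_step[of \<alpha> n] \<alpha> n by simp
    also have "\<dots> \<le> (real n - 1) * real m powr \<alpha> + 1"
      using 1 n \<alpha> by (intro add_right_mono mult_left_mono powr_mono2) auto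
    finally have *: "real n powr (1 + \<alpha>) \<le> (real n - 1) * real m powr \<alpha> + 1" .
    have "real m powr (1 + \<alpha>) + real n powr (1 + \<alpha>) \<le> real m powr (1 + \<alpha>) * (1 + y) + 1"
    proof -
      have "real m powr (1 + \<alpha>) * (1 + y) = real m powr (1 + \<alpha>) + (real n - 1) * real m powr \<alpha>"
        using n by (simp add: y_def powr_add distrib_left)
      then show ?thesis using * by simp
    qed
    also have "real m powr (1 + \<alpha>) * (1 + y) \<le> real m powr (1 + \<alpha>) * exp y"
      by (intro mult_left_mono exp_ge_add_one_self) auto
    finally show ?thesis using E1 by simp
  next
    case 2
    then show ?thesis using E1 by (simp add: y_def)
  next
    case 3
    then have "S \<le> 2 + 2 powr \<alpha>" using S(2) by (simp add: numeral_2_eq_2)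
    from power_gap_two[OF \<alpha> S(1) this] 3 show ?thesis by simp
  next
    case 4
    then show ?thesis using E power_gap_three[OF \<alpha>] by (simp add: y_def)
  next
    case 5
    then have "3/4 \<le> y" by (simp add: y_def field_simps)
    then have "2 \<le> exp y" using two_le_exp_three_quarters by (meson exp_le_cancel_iff order.trans)
    then have "real m powr (1 + \<alpha>) * 2 \<le> real m powr (1 + \<alpha>) * exp y" by (intro mult_left_mono) auto
    with E1 have "real m powr (1 + \<alpha>) * 2 \<le> ?E" by linarith
    then show ?thesis using 5 by simp
  qed
qed

section \<open>Entropies\<close>

text \<open>Gibbs' inequality against the tilted distribution \<open>q^\<beta> / S\<close>: apply
  \<open>ln z \<le> z - 1\<close> to \<open>z = q^(\<beta> - 1) / S\<close>, weight by
  \<open>q\<close> and sum. The right side sums to \<open>1 - 1 = 0\<close>.\<close>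

lemma renyi_le_shannon:
  fixes q :: "'a \<Rightarrow> real"
  assumes U: "finite U" and q: "\<And>x. x \<in> U \<Longrightarrow> q x \<ge> 0" "sum q U = 1" and \<beta>: "\<beta> > 1"
  shows "1 / (1 - \<beta>) * ln (\<Sum>x\<in>U. q x powr \<beta>) \<le> - (\<Sum>x\<in>U. q x * ln (q x))"
proof -
  define S where "S = (\<Sum>x\<in>U. q x powr \<beta>)"
  have "\<exists>x\<in>U. q x > 0"
  proof (rule ccontr)
    assume "\<not> ?thesis"
    then have "q x = 0" if "x \<in> U" for x using q(1)[OF that] that by force
    then show False using q(2) by simp
  qed
  then obtain x0 where x0: "x0 \<in> U" "q x0 > 0" by blast
  have S: "S > 0" unfolding S_def using x0 by (intro sum_pos2[OF U]) auto
  have "(\<beta> - 1) * (q x * ln (q x)) - q x * ln S \<le> q x powr \<beta> / S - q x" if x: "x \<in> U" for x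
  proof (cases "q x = 0")
    case True
    then show ?thesis by simp
  next
    case False
    with q(1)[OF x] have pos: "q x > 0" by simp
    have "(\<beta> - 1) * ln (q x) - ln S = ln (q x powr (\<beta> - 1) / S)"
      using pos S by (simp add: ln_div ln_powr)
    also have "\<dots> \<le> q x powr (\<beta> - 1) / S - 1" using pos S by (intro ln_le_minus_one) auto
    finally have "q x * ((\<beta> - 1) * ln (q x) - ln S) \<le> q x * (q x powr (\<beta> - 1) / S - 1)"
      using pos by (intro mult_left_mono) auto
    also have "\<dots> = q x powr \<beta> / S - q x" using pos by (simp add: powr_diff algebra_simps)
    finally show ?thesis by (simp add: algebra_simps)
  qed
  then have "(\<Sum>x\<in>U. (\<beta> - 1) * (q x * ln (q x)) - q x * ln S) \<le> (\<Sum>x\<in>U. q x powr \<beta> / S - q x)"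
    by (intro sum_mono)
  then have "(\<beta> - 1) * (\<Sum>x\<in>U. q x * ln (q x)) - ln S \<le> 0"
    using S q(2) unfolding sum_subtractf sum_distrib_left[symmetric] sum_distrib_right[symmetric]
      sum_divide_distrib[symmetric] S_def[symmetric] by simp
  then show ?thesis unfolding S_def[symmetric] using \<beta> by (simp add: field_simps)
qed

section \<open>The power inequality for representation counts\<close>

lemma convolution_power_ineq_le:
  fixes A B U :: "(int ^ 'd) set" and \<alpha> :: real
  assumes fin: "finite A" "finite B" "finite U" and U: "\<And>a b. a \<in> A \<Longrightarrow> b \<in> B \<Longrightarrow> a + b \<in> U"
    and ne: "A \<noteq> {}" "B \<noteq> {}" and \<alpha>: "\<alpha> > 1"
    and le: "card B \<le> card A"
  shows "card A powr (1 + \<alpha>) + card B powr (1 + \<alpha>) \<le>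
    exp ((1 + \<alpha>) * (1 / (1 - \<alpha>) * ln (\<Sum>x\<in>U. (rep A B x / (card A * card B)) powr \<alpha>))) + 1"
proof -
  define S where "S = (\<Sum>x\<in>U. real (rep A B x) powr \<alpha>)"
  have card: "card A > 0" "card B > 0" using fin ne by (auto simp: card_gt_0_iff)
  have "(\<Sum>x\<in>U. rep A B x) = card A * card B" using fin U by (rule sum_rep)
  then have "(\<Sum>x\<in>U. rep A B x) \<noteq> 0" using card by (metis mult_is_0 less_irrefl)
  then obtain x where "x \<in> U" "rep A B x \<noteq> 0"
    by (rule sum.not_neutral_contains_not_neutral)
  then have S: "S > 0" unfolding S_def using fin by (intro sum_pos2[of U x]) auto
  have "S \<le> 2 * (\<Sum>k<card B. real k powr \<alpha>) + (real (card A) - card B + 1) * real (card B) powr \<alpha>"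
    unfolding S_def using assms by (intro sum_rep_powr_le) auto
  then have "card A powr (1 + \<alpha>) + card B powr (1 + \<alpha>) \<le>
      exp ((1 + \<alpha>) * (1 / (1 - \<alpha>) * ln (S / (real (card A) * real (card B)) powr \<alpha>))) + 1"
    using le card S \<alpha> by (intro trapezoid_power_ineq) auto
  moreover have "(\<Sum>x\<in>U. (rep A B x / (card A * card B)) powr \<alpha>) = S / (real (card A) * real (card B)) powr \<alpha>"
    unfolding S_def sum_divide_distrib by (intro sum.cong) (auto simp: powr_divide)
  ultimately show ?thesis by simp
qed

lemma convolution_power_ineq_gt:
  fixes A B U :: "(int ^ 'd) set" and \<alpha> :: real
  assumes fin: "finite A" "finite B" "finite U" and U: "\<And>a b. a \<in> A \<Longrightarrow> b \<in> B \<Longrightarrow> a + b \<in> U"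
    and ne: "A \<noteq> {}" "B \<noteq> {}" and \<alpha>: "\<alpha> > 1"
  shows "card A powr (1 + \<alpha>) + card B powr (1 + \<alpha>) \<le>
    exp ((1 + \<alpha>) * (1 / (1 - \<alpha>) * ln (\<Sum>x\<in>U. (rep A B x / (card A * card B)) powr \<alpha>))) + 1"
  using fin U ne
proof (cases "card B \<le> card A")
  case True
  then show ?thesis using assms by (intro convolution_power_ineq_le) auto
next
  case False
  have "card B powr (1 + \<alpha>) + card A powr (1 + \<alpha>) \<le>
    exp ((1 + \<alpha>) * (1 / (1 - \<alpha>) * ln (\<Sum>x\<in>U. (rep B A x / (card B * card A)) powr \<alpha>))) + 1"
  proof (rule convolution_power_ineq_le)
    show "a + b \<in> U" if "a \<in> B" "b \<in> A" for a b using U[OF that(2,1)] by (simp only: add.commute)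
  qed (use fin ne False \<alpha> in auto)
  then show ?thesis by (simp add: rep_commute[of A B] mult.commute add.commute)
qed

text \<open>The Shannon entropy \<open>H\<close> replaces the entropy of order
  \<open>\<beta>\<close> before the limit is taken, so only functions continuous in
  \<open>\<beta>\<close> pass to \<open>\<beta> = 1\<close>, and convergence of the Renyi entropies
  does not enter.\<close>

lemma convolution_power_ineq_1:
  fixes A B U :: "(int ^ 'd) set"
  assumes fin: "finite A" "finite B" "finite U" and U: "\<And>a b. a \<in> A \<Longrightarrow> b \<in> B \<Longrightarrow> a + b \<in> U"
    and ne: "A \<noteq> {}" "B \<noteq> {}"
  defines "q \<equiv> \<lambda>x. rep A B x / (real (card A) * real (card B))"
  shows "card A powr 2 + card B powr 2 \<le> exp (2 * - (\<Sum>x\<in>U. q x * ln (q x))) + 1"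
proof -
  define H where "H = - (\<Sum>x\<in>U. q x * ln (q x))"
  have card: "card A > 0" "card B > 0" using fin ne by (auto simp: card_gt_0_iff)
  have "sum q U = 1"
  proof -
    have "(\<Sum>x\<in>U. rep A B x) = card A * card B" using fin U by (rule sum_rep)
    then have "(\<Sum>x\<in>U. real (rep A B x)) = real (card A) * real (card B)"
      by (metis of_nat_sum of_nat_mult)
    then show ?thesis unfolding q_def sum_divide_distrib[symmetric] using card by simp
  qed
  then have "1 / (1 - \<beta>) * ln (\<Sum>x\<in>U. q x powr \<beta>) \<le> H" if "\<beta> > 1" for \<beta>
    unfolding H_def using fin that by (intro renyi_le_shannon) (auto simp: q_def)
  then have "exp ((1 + \<beta>) * (1 / (1 - \<beta>) * ln (\<Sum>x\<in>U. q x powr \<beta>))) \<le> exp ((1 + \<beta>) * H)" if "\<beta> > 1" for \<beta>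
    using that by (subst exp_le_cancel_iff, intro mult_left_mono) auto
  moreover have "card A powr (1 + \<beta>) + card B powr (1 + \<beta>) \<le>
      exp ((1 + \<beta>) * (1 / (1 - \<beta>) * ln (\<Sum>x\<in>U. q x powr \<beta>))) + 1" if "\<beta> > 1" for \<beta>
    using convolution_power_ineq_gt[OF fin _ ne that] U unfolding q_def of_nat_mult by blast
  ultimately have "card A powr (1 + \<beta>) + card B powr (1 + \<beta>) \<le> exp ((1 + \<beta>) * H) + 1" if "\<beta> > 1" for \<beta>
    using that by (meson add_right_mono order.trans)
  then have ev: "eventually (\<lambda>\<beta>. card A powr (1 + \<beta>) + card B powr (1 + \<beta>) \<le> exp ((1 + \<beta>) * H) + 1) (at_right (1::real))"
    by (auto simp: eventually_at_filter)
  have "card A powr (1 + 1) + card B powr (1 + 1) \<le> exp ((1 + 1) * H) + 1"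
    by (rule tendsto_le[OF _ _ _ ev], simp) (intro tendsto_intros; use card in simp)+
  then show ?thesis by (simp add: H_def)
qed

section \<open>Uniform variables and the distribution of their sum\<close>

lemma mass_fun_eq_pmf:
  assumes "Z \<in> measurable M (count_space UNIV)" "distr M (count_space UNIV) Z = measure_pmf p"
  shows "mass_fun M Z z = pmf p z"
proof -
  have "mass_fun M Z z = measure (distr M (count_space UNIV) Z) {z}"
    unfolding mass_fun_def using assms(1) by (subst measure_distr) auto
  then show ?thesis by (simp add: assms(2) measure_pmf_single)
qed

text \<open>Both summands vanish at mass \<open>0\<close>, by \<open>0 * ln 0 = 0\<close> and
  \<open>0 powr a = 0\<close>, so the infinite sums collapse to \<open>U\<close>.\<close>

lemma renyi_entropy_finite:
  assumes "finite U" "\<And>z. z \<notin> U \<Longrightarrow> mass_fun M Z z = 0"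
  shows "renyi_entropy M a Z =
    (if a = 1 then - (\<Sum>z\<in>U. mass_fun M Z z * ln (mass_fun M Z z))
     else 1 / (1 - a) * ln (\<Sum>z\<in>U. mass_fun M Z z powr a))"
proof -
  have "(\<Sum>\<^sub>\<infinity>z. f (mass_fun M Z z)) = (\<Sum>z\<in>U. f (mass_fun M Z z))" if "f 0 = 0" for f :: "real \<Rightarrow> real"
  proof -
    have "(\<Sum>\<^sub>\<infinity>z. f (mass_fun M Z z)) = (\<Sum>\<^sub>\<infinity>z\<in>U. f (mass_fun M Z z))"
      using assms that by (intro infsum_cong_neutral) auto
    then show ?thesis using assms by simp
  qed
  from this[of "\<lambda>x. x * ln x"] this[of "\<lambda>x. x powr a"] show ?thesis
    unfolding renyi_entropy_def by simp
qed

lemma renyi_power_uniform: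
  assumes Z: "Z \<in> measurable M (count_space UNIV)" "distr M (count_space UNIV) Z = measure_pmf (pmf_of_set A)"
    and A: "finite A" "A \<noteq> {}"
  shows "renyi_power M a Z = real (card A) powr (1 + a)"
proof -
  have mass: "mass_fun M Z z = indicator A z / card A" for z
    using mass_fun_eq_pmf[OF Z] A by simp
  have card: "card A > 0" using A by (simp add: card_gt_0_iff)
  have "renyi_entropy M a Z = ln (card A)"
  proof (cases "a = 1")
    case True
    have "renyi_entropy M a Z = - (\<Sum>z\<in>A. (1 / card A) * ln (1 / card A))"
      using True A by (subst renyi_entropy_finite[of A]) (auto simp: mass)
    then show ?thesis using card by (simp add: ln_div)
  next
    case False
    have "renyi_entropy M a Z = 1 / (1 - a) * ln (\<Sum>z\<in>A. (1 / card A) powr a)"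
      using False A by (subst renyi_entropy_finite[of A]) (auto simp: mass)
    also have "(\<Sum>z\<in>A. (1 / card A) powr a) = card A powr (1 - a)"
      using card by (simp add: powr_diff powr_divide)
    finally show ?thesis using False card by (simp add: ln_powr)
  qed
  then show ?thesis unfolding renyi_power_def powr_def using card by simp
qed

text \<open>The event \<open>X + Y = z\<close> splits, up to a null set, into the disjoint events
  \<open>X = a\<close>, \<open>Y = z - a\<close> for \<open>a\<close> in \<open>A\<close>;
  independence evaluates each of them.\<close>

lemma (in prob_space) mass_fun_add_uniform:
  fixes X Y :: "'a \<Rightarrow> int ^ 'd"
  assumes indep: "indep_var (count_space UNIV) X (count_space UNIV) Y"
    and X: "distr M (count_space UNIV) X = measure_pmf (pmf_of_set A)"
    and Y: "distr M (count_space UNIV) Y = measure_pmf (pmf_of_set B)"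
    and A: "finite A" "A \<noteq> {}" and B: "finite B" "B \<noteq> {}"
  shows "mass_fun M (\<lambda>w. X w + Y w) z = rep A B z / (real (card A) * real (card B))"
proof -
  note rv[measurable] = indep_var_rv1[OF indep] indep_var_rv2[OF indep]
  define E where "E a = X -` {a} \<inter> Y -` {z - a} \<inter> space M" for a
  have [measurable]: "E a \<in> sets M" for a unfolding E_def by measurable
  have prob_E: "prob (E a) = indicator A a / card A * (indicator B (z - a) / card B)" for a
  proof -
    have "prob (E a) = mass_fun M X a * mass_fun M Y (z - a)"
      using indep_varD[OF indep, of "{a}" "{z - a}"] unfolding E_def mass_fun_def
      by (simp add: vimage_def Int_def)
    then show ?thesis using A B by (simp add: mass_fun_eq_pmf[OF rv(1) X] mass_fun_eq_pmf[OF rv(2) Y])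
  qed
  have "AE x in distr M (count_space UNIV) X. x \<in> A"
    unfolding X using A by (simp add: AE_measure_pmf_iff)
  then have AE: "AE w in M. X w \<in> A" by (subst (asm) AE_distr_iff) auto
  have "mass_fun M (\<lambda>w. X w + Y w) z = prob (\<Union>a\<in>A. E a)"
    unfolding mass_fun_def
  proof (rule measure_eq_AE)
    show "AE w in M. w \<in> (\<lambda>w. X w + Y w) -` {z} \<inter> space M \<longleftrightarrow> w \<in> (\<Union>a\<in>A. E a)"
      using AE by eventually_elim (auto simp: E_def)
    \<comment> \<open>Measurability of the whole event, including the null part where
      \<open>X\<close> leaves \<open>A\<close>, comes from the countability of the lattice.\<close>
    have "(\<Union>a\<in>UNIV. E a) \<in> sets M" by (rule sets.countable_UN') auto
    also have "(\<Union>a\<in>UNIV. E a) = (\<lambda>w. X w + Y w) -` {z} \<inter> space M" by (auto simp: E_def algebra_simps)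
    finally show "(\<lambda>w. X w + Y w) -` {z} \<inter> space M \<in> sets M" .
    show "(\<Union>a\<in>A. E a) \<in> sets M" using A by (intro sets.finite_UN) auto
  qed
  also have "\<dots> = (\<Sum>a\<in>A. prob (E a))"
    using A by (intro finite_measure_finite_Union) (auto simp: disjoint_family_on_def E_def)
  also have "\<dots> = (\<Sum>a\<in>A. indicator B (z - a)) / (card A * card B)"
    unfolding prob_E sum_divide_distrib by (intro sum.cong) auto
  also have "(\<Sum>a\<in>A. indicator B (z - a)) = real (rep A B z)"
    unfolding rep_eq_card using A by (simp add: indicator_def sum.If_cases Int_def)
  finally show ?thesis by simp
qed

theorem theorem2p6:
  fixes M :: "'w measure"
    and X Y :: "'w \<Rightarrow> int ^ 'd"
    and A B :: "(int ^ 'd) set"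
    and \<alpha> :: real
  assumes "prob_space M"
    and "\<alpha> \<ge> 1"
    and "finite A" "A \<noteq> {}"
    and "finite B" "B \<noteq> {}"
    and "prob_space.indep_var M (count_space UNIV) X (count_space UNIV) Y"
    and "distr M (count_space UNIV) X = measure_pmf (pmf_of_set A)"
    and "distr M (count_space UNIV) Y = measure_pmf (pmf_of_set B)"
  shows "renyi_power M \<alpha> (\<lambda>w. X w + Y w) + 1 \<ge> renyi_power M \<alpha> X + renyi_power M \<alpha> Y"
proof -
  interpret prob_space M by fact
  note rv = indep_var_rv1[OF assms(7)] indep_var_rv2[OF assms(7)]
  \<comment> \<open>The sumset is finite and carries the whole distribution of
    \<open>X + Y\<close>.\<close>
  define U where "U = (\<lambda>(a, b). a + b) ` (A \<times> B)"
  have U: "finite U" "\<And>a b. a \<in> A \<Longrightarrow> b \<in> B \<Longrightarrow> a + b \<in> U"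
    using assms by (auto simp: U_def)
  have mass: "mass_fun M (\<lambda>w. X w + Y w) z = rep A B z / (real (card A) * real (card B))" for z
    using assms by (intro mass_fun_add_uniform) auto
  have "rep A B z = 0" if "z \<notin> U" for z
    using that U(2) assms unfolding rep_def by auto
  then have H: "renyi_entropy M \<alpha> (\<lambda>w. X w + Y w) =
     (if \<alpha> = 1 then - (\<Sum>z\<in>U. rep A B z / (real (card A) * real (card B)) * ln (rep A B z / (real (card A) * real (card B))))
      else 1 / (1 - \<alpha>) * ln (\<Sum>z\<in>U. (rep A B z / (real (card A) * real (card B))) powr \<alpha>))"
    using U(1) by (subst renyi_entropy_finite[of U]) (auto simp: mass)
  have "real (card A) powr (1 + \<alpha>) + real (card B) powr (1 + \<alpha>) \<le> renyi_power M \<alpha> (\<lambda>w. X w + Y w) + 1"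
  proof (cases "\<alpha> = 1")
    case True
    then show ?thesis
      using convolution_power_ineq_1[OF assms(3,5) U assms(4,6)] unfolding renyi_power_def H by simp
  next
    case False
    with \<open>\<alpha> \<ge> 1\<close> show ?thesis
      using convolution_power_ineq_gt[OF assms(3,5) U assms(4,6), of \<alpha>] by (simp add: renyi_power_def H)
  qed
  then show ?thesis
    using renyi_power_uniform[OF rv(1) assms(8,3,4)] renyi_power_uniform[OF rv(2) assms(9,5,6)] by simp
qed

end
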